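(* Let $\mathcal{X}\subseteq\mathbb{R}^n$ be a compact set, and let $f, h_1,\dots,h_m:\mathcal{X}\to\mathbb{R}$ be continuous functions such that $h_j(x)\ge 0$ for all $x\in\mathcal{X}$ and $j=1,\dots,m$. Then $$\inf\{f(x): x\in\mathcal{X},\ h_j(x)=0,\ j=1,\dots,m\} \;=\; \sup_{y\in\mathbb{R}^m}\ \inf_{x\in\mathcal{X}}\Big(f(x)+\sum_{j=1}^m y_j h_j(x)\Big).$$
   Context: All optimal values are taken in the extended reals $[-\infty,+\infty]$; the optimal value of an infeasible minimization problem (infimum over the empty set) is $+\infty$. *)

theory Defs
  imports "HOL-Analysis.Analysis"
begin

end

theory Submission
  imports Defs
begin

text \<open>Weak duality is immediate, since the penalty vanishes on feasible points. Conversely, let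
  \<open>c\<close> lie below the constrained infimum. On the compact sublevel set \<open>f \<le> c\<close> the total violation
  \<open>s = \<Sum>j. h j\<close> has no zero, hence is bounded below by some \<open>e > 0\<close>, so a large constant
  multiplier lifts \<open>f + k * s\<close> above \<open>c\<close> there; elsewhere \<open>f > c\<close> already.\<close>

lemma compact_exact_penalty:
  fixes f s :: "'a::t2_space \<Rightarrow> real"
  assumes X: "compact X" and f: "continuous_on X f" and s: "continuous_on X s"
    and s_nonneg: "\<And>x. x \<in> X \<Longrightarrow> s x \<ge> 0"
    and above: "\<And>x. x \<in> X \<Longrightarrow> s x = 0 \<Longrightarrow> c < f x"
  shows "\<exists>k\<ge>0. \<forall>x\<in>X. c \<le> f x + k * s x"
proof -
  define K where "K = X \<inter> f -` {..c}"
  have "closed K"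
    unfolding K_def
    by (rule continuous_closed_preimage[OF f compact_imp_closed[OF X] closed_atMost])
  then have K: "compact K"
    using compact_Int_closed[OF X, of K] by (simp add: K_def)
  have KX: "K \<subseteq> X"
    by (auto simp: K_def)
  show ?thesis
  proof (cases "K = {}")
    case True
    then have "\<forall>x\<in>X. c \<le> f x + 0 * s x"
      by (force simp: K_def)
    then show ?thesis by blast
  next
    case False
    obtain p where p: "p \<in> K" "\<And>x. x \<in> K \<Longrightarrow> s p \<le> s x"
      using continuous_attains_inf[OF K False continuous_on_subset[OF s KX]] by blast
    obtain q where q: "q \<in> K" "\<And>x. x \<in> K \<Longrightarrow> f q \<le> f x"
      using continuous_attains_inf[OF K False continuous_on_subset[OF f KX]] by blast
    have sp: "s p > 0"
      using p(1) above[of p] s_nonneg[of p] by (force simp: K_def)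
    \<comment> \<open>Largest shortfall of \<open>f\<close> below \<open>c\<close> on
      \<open>K\<close>, divided by the smallest violation there; this dominates
      \<open>(c - f x) / s x\<close> for every \<open>x\<close> in \<open>K\<close>.\<close>
    define k where "k = (c - f q) / s p"
    have k: "k \<ge> 0"
      using q(1) sp by (simp add: k_def K_def)
    have "c \<le> f x + k * s x" if x: "x \<in> X" for x
    proof (cases "x \<in> K")
      case True
      have "c - f q = k * s p"
        using sp by (simp add: k_def)
      also have "\<dots> \<le> k * s x"
        using p(2)[OF True] k by (rule mult_left_mono)
      finally show ?thesis
        using q(2)[OF True] by linarith
    next
      case False
      then have "c < f x"
        using x by (simp add: K_def)
      moreover have "0 \<le> k * s x"
        using k s_nonneg[OF x] by simp
      ultimately show ?thesis by linarith
    qed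
    then show ?thesis using k by blast
  qed
qed

theorem proposition2:
  fixes X :: "(real ^ 'n) set"
    and f :: "real ^ 'n \<Rightarrow> real"
    and m :: nat
    and h :: "nat \<Rightarrow> real ^ 'n \<Rightarrow> real"
  assumes "compact X"
    and "continuous_on X f"
    and "\<And>j. j \<in> {1..m} \<Longrightarrow> continuous_on X (h j)"
    and "\<And>j x. j \<in> {1..m} \<Longrightarrow> x \<in> X \<Longrightarrow> h j x \<ge> 0"
  shows "(INF x \<in> {x \<in> X. \<forall>j \<in> {1..m}. h j x = 0}. ereal (f x)) =
         (SUP y \<in> {1..m} \<rightarrow>\<^sub>E (UNIV :: real set).
            INF x \<in> X. ereal (f x + (\<Sum>j = 1..m. y j * h j x)))"
    (is "?L = ?R")
proof (rule antisym)
  show "?R \<le> ?L"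
  proof (intro SUP_least INF_greatest)
    fix y x assume "x \<in> {x \<in> X. \<forall>j \<in> {1..m}. h j x = 0}"
    then show "(INF x \<in> X. ereal (f x + (\<Sum>j = 1..m. y j * h j x))) \<le> ereal (f x)"
      by (intro INF_lower2[of x]) auto
  qed
  show "?L \<le> ?R"
  \<comment> \<open>Comparing real upper bounds avoids a case split on infinite values, such as
    \<open>?L\<close> being +infinity when no point is feasible.\<close>
  proof (rule ereal_le_real)
    fix z :: real assume z: "?R \<le> ereal z"
    show "?L \<le> ereal z"
    proof (rule ccontr)
      assume "\<not> ?L \<le> ereal z"
      then obtain c where c: "z < c" "ereal c < ?L"
        using ereal_dense2[of "ereal z" ?L] by (auto simp: not_le)
      \<comment> \<open>As the \<open>h j\<close> are nonnegative on \<open>X\<close>,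
        \<open>s\<close> vanishes there exactly at the feasible points, so one scalar penalty
        replaces all \<open>m\<close> constraints.\<close>
      define s where "s x = (\<Sum>j = 1..m. h j x)" for x
      have "continuous_on X s"
        unfolding s_def by (intro continuous_on_sum assms(3))
      moreover have "s x \<ge> 0" if "x \<in> X" for x
        unfolding s_def by (intro sum_nonneg assms(4) that)
      moreover have "c < f x" if x: "x \<in> X" "s x = 0" for x
      proof -
        have "\<forall>j \<in> {1..m}. h j x = 0"
          using x assms(4) sum_nonneg_eq_0_iff[of "{1..m}" "\<lambda>j. h j x"] by (simp add: s_def)
        then have "?L \<le> ereal (f x)"
          using x by (intro INF_lower) auto
        with c(2) have "ereal c < ereal (f x)"
          by (rule less_le_trans)
        then show ?thesis by simp
      qed
      ultimately obtain k where k: "\<And>x. x \<in> X \<Longrightarrow> c \<le> f x + k * s x"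
        using compact_exact_penalty[OF assms(1,2)] by blast
      \<comment> \<open>Equal multipliers turn the Lagrangian into \<open>f x + k * s x\<close>; the
        restriction to \<open>{1..m}\<close> puts \<open>y\<close> in the extensional function space
        that models the multiplier vectors.\<close>
      define y where "y = (\<lambda>j \<in> {1..m}. k)"
      have "ereal c \<le> (INF x \<in> X. ereal (f x + (\<Sum>j = 1..m. y j * h j x)))"
        using k by (intro INF_greatest) (simp add: y_def s_def sum_distrib_left)
      also have "\<dots> \<le> ?R"
        unfolding y_def by (intro SUP_upper restrict_PiE_iff[THEN iffD2]) simp
      finally show False
        using z c(1) by (meson ereal_less_eq(3) order_trans not_le)
    qed
  qed
qed

end
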